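(* Let $(\alpha_k)_{k\ge1},(\beta_k)_{k\ge1},(\gamma_k)_{k\ge1}$ be weight sequences with $\alpha(x)=\sum_{k\ge1}\alpha_kx^k$, $\beta(x)=\sum_{k\ge1}\beta_kx^k$, $\gamma(x)=\sum_{k\ge1}\gamma_kx^k$, and let $V_n$ be the total weight of the set $\mathcal{V}_n$ of weighted Dyck paths of length $2n$ described in the context. Then, as formal power series, $$\sum_{n\ge0}V_nx^n=\frac{1}{1-\gamma(x)-\frac{\alpha(x)^2\beta(x)}{1-\alpha(x)}}.$$
   Context: A Dyck path of length $2n$ is a lattice path from $(0,0)$ to $(2n,0)$ with steps $\mathbf{u}=(1,1)$ and $\mathbf{d}=(1,-1)$ that never goes below the $x$-axis. A valley is an occurrence of $\mathbf{du}$; its level is the ordinate of the common point of its two steps. A pyramid is a consecutive section $\mathbf{u}^h\mathbf{d}^h$ ($h\ge1$ is its height); it is maximal if it cannot be extended to a section $\mathbf{u}^{h+1}\mathbf{d}^{h+1}$; its altitude is the ordinate of the endpoint of its last $\mathbf{d}$-step. A Dyck path is primitive if it is nonempty and touches the $x$-axis only at its two endpoints. Let $\mathcal{A}_n$ be the set of primitive Dyck paths $P$ of length $2n$ all of whose valleys (if any) lie at the same level, each carrying a weight $w(P)$ defined as follows: if $P$ has no valley, then $P=\mathbf{u}^n\mathbf{d}^n$ is a maximal pyramid of height $n$ at altitude $0$ and $w(P)=\gamma_n$; otherwise all valleys are at a common level $k\ge1$ and $P=\mathbf{u}^k\,\mathbf{u}^{i_1}\mathbf{d}^{i_1}\cdots\mathbf{u}^{i_r}\mathbf{d}^{i_r}\,\mathbf{d}^k$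 with $r\ge2$, $i_1,\dots,i_r\ge1$ (the $\mathbf{u}^{i_j}\mathbf{d}^{i_j}$ being the maximal pyramids at altitude $k$), and $w(P)=\beta_k\alpha_{i_1}\cdots\alpha_{i_r}$ (each maximal pyramid of height $i$ at altitude $\ge1$ contributes $\alpha_i$, and the initial segment $\mathbf{u}^k$ contributes $\beta_k$). Only paths of nonzero weight are kept in $\mathcal{A}_n$. Let $\mathcal{V}_n$ be the set of Dyck paths of length $2n$ that are concatenations $P_1P_2\cdots P_m$ ($m\ge0$; $m=0$ gives the empty path) of paths $P_j\in\bigcup_{s\ge1}\mathcal{A}_s$, with weight $w(P_1\cdots P_m)=\prod_j w(P_j)$ (the empty path has weight $1$), and let $V_n=\sum_{P\in\mathcal{V}_n}w(P)$. *)

theory Defs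
  imports "HOL-Computational_Algebra.Formal_Power_Series"
begin

datatype step = Up | Down

fun rise :: "step \<Rightarrow> int" where
  "rise Up = 1"
| "rise Down = -1"

text \<open>A lattice path starting at the origin is its list of steps; \<open>ordinate P i\<close> is the height
  of its vertex with abscissa \<open>i\<close>.\<close>

definition ordinate :: "step list \<Rightarrow> nat \<Rightarrow> int" where
  "ordinate P i = (\<Sum>s\<leftarrow>take i P. rise s)"

definition dyck_path :: "nat \<Rightarrow> step list \<Rightarrow> bool" where
  "dyck_path n P \<longleftrightarrow>
     length P = 2 * n \<and> ordinate P (2 * n) = 0 \<and> (\<forall>i\<le>2 * n. ordinate P i \<ge> 0)"

text \<open>A valley is identified by the abscissa of the common point of its two steps.\<close>

definition valley :: "step list \<Rightarrow> nat \<Rightarrow> bool" where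
  "valley P i \<longleftrightarrow> 0 < i \<and> i < length P \<and> P ! (i - 1) = Down \<and> P ! i = Up"

definition valley_levels :: "step list \<Rightarrow> int set" where
  "valley_levels P = {ordinate P i | i. valley P i}"

text \<open>\<open>pyramid P i h\<close>: the section of \<open>P\<close> starting at abscissa \<open>i\<close> and of length \<open>2 * h\<close> is a
  pyramid of height \<open>h\<close>. An extension by one step on each side starts at \<open>i - 1\<close>.\<close>

definition pyramid :: "step list \<Rightarrow> nat \<Rightarrow> nat \<Rightarrow> bool" where
  "pyramid P i h \<longleftrightarrow>
     h \<ge> 1 \<and> take (2 * h) (drop i P) = replicate h Up @ replicate h Down"

definition maximal_pyramid :: "step list \<Rightarrow> nat \<Rightarrow> nat \<Rightarrow> bool" where
  "maximal_pyramid P i h \<longleftrightarrow> pyramid P i h \<and> \<not> (i \<ge> 1 \<and> pyramid P (i - 1) (h + 1))"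

definition altitude :: "step list \<Rightarrow> nat \<Rightarrow> nat \<Rightarrow> int" where
  "altitude P i h = ordinate P (i + 2 * h)"

definition primitive_path :: "nat \<Rightarrow> step list \<Rightarrow> bool" where
  "primitive_path n P \<longleftrightarrow>
     dyck_path n P \<and> P \<noteq> [] \<and> (\<forall>i\<le>2 * n. ordinate P i = 0 \<longrightarrow> i = 0 \<or> i = 2 * n)"

text \<open>Weight of a primitive path whose valleys all lie at the same level (the unique element of
  \<open>valley_levels P\<close> in the second case, which is also the length of the initial segment
  contributing \<open>\<beta>\<close>); irrelevant for other paths.\<close>

definition primitive_weight ::
  "(nat \<Rightarrow> 'a::field) \<Rightarrow> (nat \<Rightarrow> 'a) \<Rightarrow> (nat \<Rightarrow> 'a) \<Rightarrow> step list \<Rightarrow> 'a" where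
  "primitive_weight \<alpha> \<beta> \<gamma> P =
     (if valley_levels P = {} then \<gamma> (length P div 2)
      else \<beta> (nat (the_elem (valley_levels P))) *
           (\<Prod>(i, h)\<in>{(i, h). maximal_pyramid P i h \<and> altitude P i h \<ge> 1}. \<alpha> h))"

definition \<A> ::
  "(nat \<Rightarrow> 'a::field) \<Rightarrow> (nat \<Rightarrow> 'a) \<Rightarrow> (nat \<Rightarrow> 'a) \<Rightarrow> nat \<Rightarrow> step list set" where
  "\<A> \<alpha> \<beta> \<gamma> n =
     {P. primitive_path n P \<and> (\<exists>k. valley_levels P \<subseteq> {k}) \<and> primitive_weight \<alpha> \<beta> \<gamma> P \<noteq> 0}"

definition \<V> ::
  "(nat \<Rightarrow> 'a::field) \<Rightarrow> (nat \<Rightarrow> 'a) \<Rightarrow> (nat \<Rightarrow> 'a) \<Rightarrow> nat \<Rightarrow> step list set" where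
  "\<V> \<alpha> \<beta> \<gamma> n =
     {P. dyck_path n P \<and> (\<exists>Ps. set Ps \<subseteq> (\<Union>s\<in>{1..}. \<A> \<alpha> \<beta> \<gamma> s) \<and> P = concat Ps)}"

text \<open>The factors are recovered from the path: a Dyck path has a unique factorization into
  primitive ones, cut at its returns to the axis.\<close>

definition path_weight ::
  "(nat \<Rightarrow> 'a::field) \<Rightarrow> (nat \<Rightarrow> 'a) \<Rightarrow> (nat \<Rightarrow> 'a) \<Rightarrow> step list \<Rightarrow> 'a" where
  "path_weight \<alpha> \<beta> \<gamma> P =
     (let Ps = (THE Ps. set Ps \<subseteq> (\<Union>s\<in>{1..}. \<A> \<alpha> \<beta> \<gamma> s) \<and> P = concat Ps)
      in \<Prod>Q\<leftarrow>Ps. primitive_weight \<alpha> \<beta> \<gamma> Q)"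

definition total_weight ::
  "(nat \<Rightarrow> 'a::field) \<Rightarrow> (nat \<Rightarrow> 'a) \<Rightarrow> (nat \<Rightarrow> 'a) \<Rightarrow> nat \<Rightarrow> 'a" where
  "total_weight \<alpha> \<beta> \<gamma> n = (\<Sum>P\<in>\<V> \<alpha> \<beta> \<gamma> n. path_weight \<alpha> \<beta> \<gamma> P)"

text \<open>Weight sequences are indexed from 1; their value at 0 is never used.\<close>

definition weight_fps :: "(nat \<Rightarrow> 'a::field) \<Rightarrow> 'a fps" where
  "weight_fps a = Abs_fps (\<lambda>k. if k \<ge> 1 then a k else 0)"

end

theory Submission
  imports Defs
begin

text \<open>A primitive path with all valleys on one level is either a single pyramid
  or a row of at least two pyramids between \<open>k \<ge> 1\<close> up steps and \<open>k\<close> down steps. The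
  second kind is parametrized by \<open>k\<close>, the first two pyramid heights and the list of the
  remaining ones, which gives \<open>\<beta> \<cdot> \<alpha> \<cdot> \<alpha> \<cdot> 1 / (1 - \<alpha>)\<close>. As a Dyck path factors uniquely
  into primitive ones, the paths of \<open>\<V>\<close> correspond to lists of such paths, whose generating
  function is again a geometric series.\<close>

section \<open>Generating functions of graded sets\<close>

text \<open>Meaningful only for sets with finite levels: the sum over an infinite level is 0.\<close>

definition gf :: "'b set \<Rightarrow> ('b \<Rightarrow> nat) \<Rightarrow> ('b \<Rightarrow> 'a::field) \<Rightarrow> 'a fps" where
  "gf S sz w = Abs_fps (\<lambda>n. \<Sum>b\<in>{b\<in>S. sz b = n}. w b)"

definition finite_levels :: "'b set \<Rightarrow> ('b \<Rightarrow> nat) \<Rightarrow> bool" where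
  "finite_levels S sz \<longleftrightarrow> (\<forall>n. finite {b\<in>S. sz b = n})"

lemma finite_levels_atMost:
  assumes "finite_levels S sz"
  shows "finite {b\<in>S. sz b \<le> n}"
proof -
  have "{b\<in>S. sz b \<le> n} = (\<Union>m\<le>n. {b\<in>S. sz b = m})" by auto
  then show ?thesis using assms by (simp add: finite_levels_def)
qed

lemma finite_levels_subset:
  assumes "finite_levels T sz" "S \<subseteq> T"
  shows "finite_levels S sz"
  unfolding finite_levels_def
proof
  fix n
  have "{b\<in>S. sz b = n} \<subseteq> {b\<in>T. sz b = n}" using assms(2) by auto
  then show "finite {b\<in>S. sz b = n}"
    by (rule finite_subset) (use assms(1) in \<open>simp add: finite_levels_def\<close>)
qed

lemma finite_levels_Times:
  assumes "finite_levels S sS" "finite_levels T sT"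
  shows "finite_levels (S \<times> T) (\<lambda>(a, b). sS a + sT b)"
  unfolding finite_levels_def
proof
  fix n
  have "{p\<in>S \<times> T. (case p of (a, b) \<Rightarrow> sS a + sT b) = n}
      \<subseteq> {a\<in>S. sS a \<le> n} \<times> {b\<in>T. sT b \<le> n}" by auto
  then show "finite {p\<in>S \<times> T. (case p of (a, b) \<Rightarrow> sS a + sT b) = n}"
    by (rule finite_subset) (simp add: finite_levels_atMost assms)
qed

text \<open>Since every entry has size at least 1, a list of total size \<open>n\<close> has at most
  \<open>n\<close> entries, each of size at most \<open>n\<close>.\<close>

lemma finite_levels_lists:
  assumes "finite_levels S sz" and pos: "\<And>b. b \<in> S \<Longrightarrow> sz b \<ge> 1"
  shows "finite_levels (lists S) (\<lambda>xs. sum_list (map sz xs))"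
  unfolding finite_levels_def
proof
  fix n
  have "length xs \<le> sum_list (map sz xs)" if "xs \<in> lists S" for xs
    using that
  proof induction
    case (Cons x xs)
    then show ?case using pos[of x] by simp
  qed simp
  then have "{xs\<in>lists S. sum_list (map sz xs) = n}
      \<subseteq> {xs. set xs \<subseteq> {b\<in>S. sz b \<le> n} \<and> length xs \<le> n}"
    by (auto intro: member_le_sum_list)
  then show "finite {xs\<in>lists S. sum_list (map sz xs) = n}"
    by (rule finite_subset) (rule finite_lists_length_le[OF finite_levels_atMost[OF assms(1)]])
qed

lemma gf_bij:
  assumes "bij_betw f S T"
    and "\<And>a. a \<in> S \<Longrightarrow> sz' (f a) = sz a" "\<And>a. a \<in> S \<Longrightarrow> w' (f a) = w a"
  shows "gf T sz' w' = gf S sz w"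
proof -
  have "(\<Sum>b\<in>{b\<in>T. sz' b = n}. w' b) = (\<Sum>a\<in>{a\<in>S. sz a = n}. w a)" for n
  proof (rule sum.reindex_bij_betw[symmetric, THEN trans])
    show "bij_betw f {a\<in>S. sz a = n} {b\<in>T. sz' b = n}"
      using assms(1,2) by (auto simp: bij_betw_def inj_on_def)
    show "(\<Sum>x\<in>{a\<in>S. sz a = n}. w' (f x)) = (\<Sum>a\<in>{a\<in>S. sz a = n}. w a)"
      using assms(3) by (intro sum.cong) auto
  qed
  then show ?thesis by (simp add: gf_def)
qed

lemma gf_Un:
  assumes "finite_levels S sz" "finite_levels T sz" "S \<inter> T = {}"
  shows "gf (S \<union> T) sz w = gf S sz w + gf T sz w"
proof (rule fps_ext)
  fix n
  have "{b\<in>S \<union> T. sz b = n} = {b\<in>S. sz b = n} \<union> {b\<in>T. sz b = n}" by auto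
  moreover have "sum w ({b\<in>S. sz b = n} \<union> {b\<in>T. sz b = n})
      = sum w {b\<in>S. sz b = n} + sum w {b\<in>T. sz b = n}"
    using assms by (intro sum.union_disjoint) (auto simp: finite_levels_def)
  ultimately show "fps_nth (gf (S \<union> T) sz w) n = fps_nth (gf S sz w + gf T sz w) n"
    by (simp add: gf_def)
qed

text \<open>Needed because \<open>\<A>\<close> keeps only paths of nonzero weight; zero summands can
  be put back, which makes the set independent of the weights.\<close>

lemma gf_nonzero:
  assumes "finite_levels S sz"
  shows "gf {b\<in>S. w b \<noteq> 0} sz w = gf S sz w"
proof -
  have "(\<Sum>b\<in>{b\<in>{b\<in>S. w b \<noteq> 0}. sz b = n}. w b) = (\<Sum>b\<in>{b\<in>S. sz b = n}. w b)" for n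
    using assms by (intro sum.mono_neutral_left) (auto simp: finite_levels_def)
  then show ?thesis by (simp add: gf_def)
qed

text \<open>Level \<open>n\<close> of the product is the disjoint union of the products of level
  \<open>i\<close> and level \<open>n - i\<close>, which is the Cauchy product of
  coefficients.\<close>

lemma gf_Times:
  assumes "finite_levels S sS" "finite_levels T sT"
  shows "gf (S \<times> T) (\<lambda>(a, b). sS a + sT b) (\<lambda>(a, b). wS a * wT b) = gf S sS wS * gf T sT wT"
proof (rule fps_ext)
  fix n
  let ?S = "\<lambda>n. {a\<in>S. sS a = n}" and ?T = "\<lambda>n. {b\<in>T. sT b = n}"
  have "{p\<in>S \<times> T. (case p of (a, b) \<Rightarrow> sS a + sT b) = n} = (\<Union>i\<in>{0..n}. ?S i \<times> ?T (n - i))"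
    by auto
  then have "fps_nth (gf (S \<times> T) (\<lambda>(a, b). sS a + sT b) (\<lambda>(a, b). wS a * wT b)) n
      = (\<Sum>p\<in>(\<Union>i\<in>{0..n}. ?S i \<times> ?T (n - i)). case p of (a, b) \<Rightarrow> wS a * wT b)"
    by (simp add: gf_def)
  also have "\<dots> = (\<Sum>i=0..n. \<Sum>p\<in>?S i \<times> ?T (n - i). case p of (a, b) \<Rightarrow> wS a * wT b)"
    using assms by (intro sum.UNION_disjoint) (auto simp: finite_levels_def)
  also have "\<dots> = (\<Sum>i=0..n. (\<Sum>a\<in>?S i. wS a) * (\<Sum>b\<in>?T (n - i). wT b))"
    by (simp add: sum_product sum.cartesian_product)
  finally show "fps_nth (gf (S \<times> T) (\<lambda>(a, b). sS a + sT b) (\<lambda>(a, b). wS a * wT b)) n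
      = fps_nth (gf S sS wS * gf T sT wT) n"
    by (simp add: gf_def fps_mult_nth)
qed

text \<open>A list is empty or a head followed by a list, so the series \<open>L\<close> of lists
  satisfies \<open>L = 1 + G * L\<close> with \<open>G = gf S sz w\<close>. No element has size 0,
  hence \<open>1 - G\<close> has constant coefficient 1 and is invertible.\<close>

lemma gf_lists:
  assumes fin: "finite_levels S sz" and pos: "\<And>b. b \<in> S \<Longrightarrow> sz b \<ge> 1"
  shows "gf (lists S) (\<lambda>xs. sum_list (map sz xs)) (\<lambda>xs. \<Prod>x\<leftarrow>xs. w x) = 1 / (1 - gf S sz w)"
    (is "?L = _")
proof -
  let ?sz = "\<lambda>xs. sum_list (map sz xs)" and ?w = "\<lambda>xs. \<Prod>x\<leftarrow>xs. w x"
  let ?N = "case_prod (#) ` (S \<times> lists S)"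
  have split: "lists S = {[]} \<union> ?N"
    by (auto simp: image_iff lists_eq_set elim: lists.cases)
       (metis list.exhaust list.set_intros(1) set_subset_Cons subset_trans subsetD)
  have finl: "finite_levels (lists S) ?sz"
    using assms by (rule finite_levels_lists)
  have "?L = gf {[]} ?sz ?w + gf ?N ?sz ?w"
    by (subst split, intro gf_Un finite_levels_subset[OF finl]) auto
  also have "gf ?N ?sz ?w
      = gf (S \<times> lists S) (\<lambda>(a, b). sz a + ?sz b) (\<lambda>(a, b). w a * ?w b)"
    by (rule gf_bij[where f = "case_prod (#)"]) (auto simp: bij_betw_def inj_on_def)
  also have "\<dots> = gf S sz w * ?L"
    by (rule gf_Times[OF fin finl])
  also have "gf {[]} ?sz ?w = 1"
  proof (rule fps_ext)
    fix n
    have "{xs\<in>{[]}. ?sz xs = n} = (if n = 0 then {[]} else {})" by auto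
    then show "fps_nth (gf {[]} ?sz ?w) n = fps_nth 1 n" by (simp add: gf_def)
  qed
  finally have eq: "?L * (1 - gf S sz w) = 1"
    by (simp add: algebra_simps)
  have empty: "{b\<in>S. sz b = 0} = {}" using pos by fastforce
  have "fps_nth (1 - gf S sz w) 0 \<noteq> 0" by (simp add: gf_def empty del: Collect_empty_eq)
  then show ?thesis
    using eq by (metis fps_divide_unit fps_inverse_unique mult.commute mult_1)
qed

lemma gf_weight_fps: "gf {1..} (\<lambda>n. n) a = weight_fps a"
proof (rule fps_ext)
  fix n :: nat
  have "{b\<in>{1..}. b = n} = (if n \<ge> 1 then {n} else {})" by auto
  then show "fps_nth (gf {1..} (\<lambda>n. n) a) n = fps_nth (weight_fps a) n"
    by (simp add: gf_def weight_fps_def)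
qed

lemma finite_levels_nat: "finite_levels (S :: nat set) (\<lambda>n. n)"
  by (simp add: finite_levels_def)

section \<open>Ordinates and valleys\<close>

abbreviation height :: "step list \<Rightarrow> int" where
  "height P \<equiv> \<Sum>s\<leftarrow>P. rise s"

lemma ordinate_simps [simp]:
  "ordinate P 0 = 0" "ordinate [] i = 0"
  "ordinate (s # P) (Suc i) = rise s + ordinate P i"
  by (simp_all add: ordinate_def)

lemma ordinate_append:
  "ordinate (xs @ ys) i = ordinate xs i + ordinate ys (i - length xs)"
  by (simp add: ordinate_def)

lemma ordinate_length_le: "length P \<le> i \<Longrightarrow> ordinate P i = height P"
  by (simp add: ordinate_def)

lemma dyck_path_iff:
  "dyck_path n P \<longleftrightarrow> length P = 2 * n \<and> height P = 0 \<and> (\<forall>i. ordinate P i \<ge> 0)"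
  unfolding dyck_path_def
  by (metis linear order_refl ordinate_length_le)

lemma dyck_path_Nil: "dyck_path 0 []"
  by (simp add: dyck_path_iff)

lemma dyck_path_append: "dyck_path m P \<Longrightarrow> dyck_path n Q \<Longrightarrow> dyck_path (m + n) (P @ Q)"
  by (simp add: dyck_path_iff ordinate_append)

lemma primitive_path_pos: "primitive_path n P \<Longrightarrow> n \<ge> 1"
  by (cases n) (auto simp: primitive_path_def dyck_path_iff)

lemma primitive_path_elevate:
  assumes "dyck_path n P"
  shows "primitive_path (Suc n) (Up # P @ [Down])"
proof -
  have len: "length P = 2 * n" and h: "height P = 0" and nn: "\<And>i. ordinate P i \<ge> 0"
    using assms by (auto simp: dyck_path_iff)
  \<comment> \<open>One bound serves twice: it gives nonnegativity everywhere and excludes returns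
    to the axis strictly between the endpoints.\<close>
  have ord: "ordinate (Up # P @ [Down]) i \<ge> (if i = 0 \<or> i \<ge> 2 * n + 2 then 0 else 1)" for i
  proof (cases i)
    case (Suc j)
    show ?thesis
    proof (cases "j \<le> 2 * n")
      case True
      then show ?thesis using Suc nn[of j] len by (simp add: ordinate_append)
    next
      case False
      \<comment> \<open>Beyond \<open>P\<close> the final \<open>Down\<close> has been taken and
        cancels the leading \<open>Up\<close>.\<close>
      then obtain m where "j - 2 * n = Suc m" by (metis Suc_diff_Suc not_le)
      then show ?thesis
        using Suc False nn[of j] len by (simp add: ordinate_append)
    qed
  qed simp
  have "ordinate (Up # P @ [Down]) i \<ge> 0" for i
    using ord[of i] by (auto split: if_splits)
  moreover have "i = 0 \<or> i = 2 * Suc n"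
    if "i \<le> 2 * Suc n" "ordinate (Up # P @ [Down]) i = 0" for i
    using ord[of i] that by (auto split: if_splits)
  ultimately show ?thesis
    using len h by (simp add: primitive_path_def dyck_path_iff)
qed

lemma valley_append:
  "valley (xs @ ys) i \<longleftrightarrow> valley xs i \<or> (\<exists>j. i = length xs + j \<and> valley ys j) \<or>
     (i = length xs \<and> xs \<noteq> [] \<and> ys \<noteq> [] \<and> last xs = Down \<and> hd ys = Up)"
proof -
  consider "i < length xs" | "i = length xs" | j where "j > 0" "i = length xs + j"
    by (metis less_imp_add_positive linorder_neqE_nat)
  then show ?thesis
  proof cases
    case 1
    then show ?thesis by (auto simp: valley_def nth_append)
  next
    case 2
    then show ?thesis
      by (auto simp: valley_def nth_append last_conv_nth hd_conv_nth)
  next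
    case 3
    then show ?thesis by (auto simp: valley_def nth_append)
  qed
qed

text \<open>The rewrite rule by which the valley levels of all paths below are computed; the last
  set is for a valley created at the junction.\<close>

lemma valley_levels_append:
  "valley_levels (xs @ ys) = valley_levels xs \<union> (+) (height xs) ` valley_levels ys \<union>
     (if xs \<noteq> [] \<and> ys \<noteq> [] \<and> last xs = Down \<and> hd ys = Up then {height xs} else {})"
proof -
  have l: "ordinate (xs @ ys) i = ordinate xs i" if "valley xs i" for i
    using that by (simp add: valley_def ordinate_append)
  have r: "ordinate (xs @ ys) (length xs + j) = height xs + ordinate ys j" for j
    by (simp add: ordinate_append ordinate_length_le)
  have "valley_levels (xs @ ys) = {ordinate (xs @ ys) i | i. valley xs i}
      \<union> {ordinate (xs @ ys) (length xs + j) | j. valley ys j}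
      \<union> (if xs \<noteq> [] \<and> ys \<noteq> [] \<and> last xs = Down \<and> hd ys = Up
          then {ordinate (xs @ ys) (length xs)} else {})"
    unfolding valley_levels_def valley_append by auto
  also have "{ordinate (xs @ ys) i | i. valley xs i} = valley_levels xs"
    unfolding valley_levels_def using l by metis
  also have "{ordinate (xs @ ys) (length xs + j) | j. valley ys j}
      = (+) (height xs) ` valley_levels ys"
    unfolding valley_levels_def r by auto
  also have "ordinate (xs @ ys) (length xs) = height xs"
    using r[of 0] by simp
  finally show ?thesis .
qed

lemma valley_levels_replicate [simp]: "valley_levels (replicate n s) = {}"
  by (auto simp: valley_levels_def valley_def)

lemma valley_levels_Nil [simp]: "valley_levels [] = {}"
  using valley_levels_replicate[of 0] by simp

declare sum_list_replicate [simp]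

section \<open>Rows of pyramids\<close>

definition pyr :: "nat \<Rightarrow> step list" where
  "pyr i = replicate i Up @ replicate i Down"

text \<open>The shape of a primitive path with all valleys at level \<open>k\<close>. For empty
  \<open>is\<close> it degenerates to \<open>pyr k\<close>, so single pyramids inherit facts about
  rows.\<close>

definition pyramid_row :: "nat \<Rightarrow> nat list \<Rightarrow> step list" where
  "pyramid_row k is = replicate k Up @ concat (map pyr is) @ replicate k Down"

lemma length_pyr [simp]: "length (pyr i) = 2 * i"
  by (simp add: pyr_def)

lemma height_pyr [simp]: "height (pyr i) = 0"
  by (simp add: pyr_def)

lemma pyr_eq_Nil_iff [simp]: "pyr i = [] \<longleftrightarrow> i = 0"
  by (simp add: pyr_def)

lemma valley_levels_pyr [simp]: "valley_levels (pyr i) = {}"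
  by (cases "i = 0") (simp_all add: pyr_def valley_levels_append)

lemma hd_pyr: "i \<ge> 1 \<Longrightarrow> hd (pyr i) = Up" and last_pyr: "i \<ge> 1 \<Longrightarrow> last (pyr i) = Down"
  by (simp_all add: pyr_def)

lemma length_concat_pyr [simp]: "length (concat (map pyr is)) = 2 * sum_list is"
  by (induction "is") auto

lemma height_concat_pyr [simp]: "height (concat (map pyr is)) = 0"
  by (induction "is") auto

lemma length_pyramid_row [simp]: "length (pyramid_row k is) = 2 * (k + sum_list is)"
  by (simp add: pyramid_row_def)

lemma hd_concat_pyr:
  "is \<noteq> [] \<Longrightarrow> \<forall>i\<in>set is. i \<ge> 1 \<Longrightarrow> hd (concat (map pyr is)) = Up"
  by (cases "is") (auto simp: hd_append hd_pyr)

lemma last_concat_pyr: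
  "is \<noteq> [] \<Longrightarrow> \<forall>i\<in>set is. i \<ge> 1 \<Longrightarrow> last (concat (map pyr is)) = Down"
  by (cases "is" rule: rev_cases) (auto simp: last_append last_pyr)

text \<open>A pyramid has no inner valley and returns to its starting height, so the valleys are
  exactly the junctions of neighbouring pyramids.\<close>

lemma valley_levels_concat_pyr:
  assumes "\<forall>i\<in>set is. i \<ge> 1"
  shows "valley_levels (concat (map pyr is)) = (if length is \<ge> 2 then {0} else {})"
  using assms
proof (induction "is")
  case (Cons i "is")
  then show ?case
    by (cases "is = []")
       (auto simp: valley_levels_append hd_concat_pyr last_pyr Suc_le_eq)
qed simp

lemma valley_levels_pyramid_row:
  assumes "\<forall>i\<in>set is. i \<ge> 1" "length is \<ge> 2"
  shows "valley_levels (pyramid_row k is) = {int k}"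
  using assms
  by (auto simp: pyramid_row_def valley_levels_append valley_levels_concat_pyr hd_append)

lemma dyck_path_pyramid_row: "dyck_path (k + sum_list is) (pyramid_row k is)"
proof -
  \<comment> \<open>Elevation iterated \<open>k\<close> times: from the empty path it produces a
    pyramid, from a concatenation of pyramids a row.\<close>
  have lift: "dyck_path (k + n) (replicate k Up @ P @ replicate k Down)"
    if "dyck_path n P" for k n P
  proof (induction k)
    case (Suc k)
    have "replicate (Suc k) Up @ P @ replicate (Suc k) Down
        = Up # (replicate k Up @ P @ replicate k Down) @ [Down]"
      by (simp add: replicate_append_same)
    then show ?case
      using primitive_path_elevate[OF Suc] by (simp add: primitive_path_def)
  qed (use that in simp)
  have pyr: "dyck_path i (pyr i)" for i
    using lift[OF dyck_path_Nil, of i] by (simp add: pyr_def)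
  have "dyck_path (sum_list is) (concat (map pyr is))"
    by (induction "is") (auto simp: dyck_path_Nil dyck_path_append pyr)
  then show "dyck_path (k + sum_list is) (pyramid_row k is)"
    unfolding pyramid_row_def by (rule lift)
qed

lemma pyramid_row_Suc: "pyramid_row (Suc k) is = Up # pyramid_row k is @ [Down]"
  by (simp add: pyramid_row_def replicate_append_same)

lemma pyramid_row_Nil: "pyramid_row k [] = pyr k"
  by (simp add: pyramid_row_def pyr_def)

text \<open>Stripping the first and the last step leaves the row with \<open>k - 1\<close>, a Dyck
  path, so the row is an elevated Dyck path.\<close>

lemma primitive_path_pyramid_row:
  "k \<ge> 1 \<Longrightarrow> primitive_path (k + sum_list is) (pyramid_row k is)"
  using primitive_path_elevate[OF dyck_path_pyramid_row]
  by (cases k) (simp_all add: pyramid_row_Suc)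

lemma primitive_path_pyr: "k \<ge> 1 \<Longrightarrow> primitive_path k (pyr k)"
  using primitive_path_pyramid_row[of k "[]"] by (simp add: pyramid_row_Nil)

text \<open>The length of the initial run of up steps identifies the first pyramid.\<close>

lemma concat_pyr_inject:
  assumes "\<forall>i\<in>set is. i \<ge> 1" "\<forall>j\<in>set js. j \<ge> 1" "concat (map pyr is) = concat (map pyr js)"
  shows "is = js"
proof -
  have run: "length (takeWhile ((=) Up) (pyr i @ X)) = i" if "i \<ge> 1" for i X
    using that by (cases i) (auto simp: pyr_def takeWhile_append)
  show ?thesis
    using assms
  proof (induction "is" arbitrary: js)
    case Nil
    then show ?case by (cases js) auto
  next
    case (Cons i "is")
    then obtain j js' where js: "js = j # js'" by (cases js) force+
    then have "i = j"
      using Cons.prems run[of i] run[of j] by (metis concat.simps(2) list.set_intros(1) list.simps(9))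
    then show ?case using Cons js by auto
  qed
qed

section \<open>Recovering a row of pyramids from its valley levels\<close>

lemma replicate_dropWhile_split:
  obtains n Q where "P = replicate n s @ Q" "Q = [] \<or> hd Q \<noteq> s"
proof
  show "P = replicate (length (takeWhile ((=) s) P)) s @ dropWhile ((=) s) P"
    by (metis (full_types) replicate_length_same set_takeWhileD takeWhile_dropWhile_id)
  show "dropWhile ((=) s) P = [] \<or> hd (dropWhile ((=) s) P) \<noteq> s"
    by (metis (full_types) hd_dropWhile)
qed

text \<open>Peel off the first run of \<open>c\<close> up steps and the following run of
  \<open>e\<close> down steps. If steps remain, a valley at height \<open>c - e\<close> follows, so
  \<open>c = e\<close>: a pyramid splits off and the shorter rest is handled by induction. The final
  \<open>k\<close> down steps allow \<open>Q\<close> to be a row without its initial up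
  steps.\<close>

lemma valley_levels_zero_decomp:
  assumes "valley_levels Q \<subseteq> {0}" "height Q = - int k"
  shows "\<exists>is. (\<forall>i\<in>set is. i \<ge> 1) \<and> Q = concat (map pyr is) @ replicate k Down"
  using assms
proof (induction "length Q" arbitrary: Q rule: less_induct)
  case less
  obtain c R where Q: "Q = replicate c Up @ R" and R: "R = [] \<or> hd R \<noteq> Up"
    by (rule replicate_dropWhile_split)
  obtain e S where RS: "R = replicate e Down @ S" and S: "S = [] \<or> hd S \<noteq> Down"
    by (rule replicate_dropWhile_split)
  have hQ: "int c - int e + height S = - int k"
    using less.prems(2) by (simp add: Q RS)
  show ?case
  proof (cases "S = []")
    case True
    then have "e = c + k" using hQ by simp
    then have "Q = pyr c @ replicate k Down"
      by (simp add: Q RS True pyr_def replicate_add)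
    then show ?thesis
      \<comment> \<open>For \<open>c = 0\<close> no pyramid is listed, since listed heights must be
        positive.\<close>
      by (intro exI[of _ "if c = 0 then [] else [c]"]) (auto simp: pyr_def)
  next
    case False
    then have hd: "hd S = Up" using S by (metis (full_types) step.exhaust)
    \<comment> \<open>With \<open>e = 0\<close> the rest \<open>R\<close> would start with
      \<open>Up\<close>, against the maximality of the first run. Hence the junction before
      \<open>S\<close> is a valley.\<close>
    then have e: "e > 0" using R RS False by (cases e) auto
    have vl: "valley_levels Q \<supseteq>
        insert (int c - int e) ((+) (int c - int e) ` valley_levels S)"
      using False hd e by (auto simp: Q RS valley_levels_append image_image add_ac)
    then have ce: "c = e" using less.prems(1) by auto
    have "valley_levels S \<subseteq> {0}" using vl less.prems(1) ce by auto
    moreover have "height S = - int k" using hQ ce by simp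
    ultimately obtain "is" where "\<forall>i\<in>set is. i \<ge> 1" "S = concat (map pyr is) @ replicate k Down"
      using less.hyps[of S] e by (auto simp: Q RS)
    then show ?thesis
      using ce e by (intro exI[of _ "c # is"]) (auto simp: Q RS pyr_def)
  qed
qed

text \<open>The case \<open>k = 0\<close> of the preceding decomposition, where two or more pyramids
  would create a valley.\<close>

lemma valley_levels_empty_decomp:
  assumes "valley_levels P = {}" "height P = 0"
  shows "\<exists>i. P = pyr i"
proof -
  obtain "is" where "is": "\<forall>i\<in>set is. i \<ge> 1" "P = concat (map pyr is)"
    using valley_levels_zero_decomp[of P 0] assms by auto
  then have "length is < 2"
    using assms(1) valley_levels_concat_pyr[OF "is"(1)] by (auto split: if_splits)
  then have "concat (map pyr is) = pyr (sum_list is)"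
    by (cases "is" rule: remdups_adj.cases) (auto simp: pyr_def)
  then show ?thesis using "is"(2) by blast
qed

text \<open>The first valley lies at height \<open>c - e = k\<close>, so the path starts with at
  least \<open>k\<close> up steps. Cutting these off moves all valleys to level 0 and the endpoint
  to \<open>- k\<close>, where \<open>valley_levels_zero_decomp\<close> applies.\<close>

lemma valley_levels_singleton_decomp:
  assumes "valley_levels P = {int k}" "height P = 0"
  shows "\<exists>is. (\<forall>i\<in>set is. i \<ge> 1) \<and> length is \<ge> 2 \<and> P = pyramid_row k is"
proof -
  obtain c R where P: "P = replicate c Up @ R" and R: "R = [] \<or> hd R \<noteq> Up"
    by (rule replicate_dropWhile_split)
  obtain e S where RS: "R = replicate e Down @ S" and S: "S = [] \<or> hd S \<noteq> Down"
    by (rule replicate_dropWhile_split)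
  have "S \<noteq> []" using assms(1) by (auto simp: P RS valley_levels_append split: if_splits)
  then have hd: "hd S = Up" using S by (metis (full_types) step.exhaust)
  then have e: "e > 0" using R RS \<open>S \<noteq> []\<close> by (cases e) auto
  have "int c - int e \<in> valley_levels P"
    using \<open>S \<noteq> []\<close> hd e by (auto simp: P RS valley_levels_append)
  then have c: "c = k + e" using assms(1) by auto
  define Q where "Q = replicate e Up @ R"
  have PQ: "P = replicate k Up @ Q" by (simp add: P Q_def c replicate_add)
  have "(+) (int k) ` valley_levels Q \<subseteq> {int k}"
    using assms(1) by (auto simp: PQ valley_levels_append)
  then have "valley_levels Q \<subseteq> {0}" by auto
  moreover have "height Q = - int k" using assms(2) by (simp add: PQ)
  ultimately obtain "is" where "is": "\<forall>i\<in>set is. i \<ge> 1" "Q = concat (map pyr is) @ replicate k Down"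
    using valley_levels_zero_decomp by blast
  have "length is \<ge> 2"
  proof (rule ccontr)
    assume "\<not> length is \<ge> 2"
    then have "valley_levels P = {}"
      using valley_levels_concat_pyr[OF "is"(1)]
      by (auto simp: PQ "is"(2) valley_levels_append)
    then show False using assms(1) by simp
  qed
  then show ?thesis using "is" PQ by (auto simp: pyramid_row_def)
qed

section \<open>Maximal pyramids of a row\<close>

lemma pyramid_iff_nth:
  "pyramid P i h \<longleftrightarrow> h \<ge> 1 \<and> i + 2 * h \<le> length P \<and>
     (\<forall>t<h. P ! (i + t) = Up \<and> P ! (i + h + t) = Down)"
proof
  assume p: "pyramid P i h"
  then have eq: "take (2 * h) (drop i P) = replicate h Up @ replicate h Down" and "h \<ge> 1"
    by (auto simp: pyramid_def)
  from eq have "length (take (2 * h) (drop i P)) = 2 * h" by simp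
  \<comment> \<open>A section cut short by the end of \<open>P\<close> would have fewer than
    \<open>2 * h\<close> steps.\<close>
  then have len: "i + 2 * h \<le> length P" using \<open>h \<ge> 1\<close> by (simp split: if_splits)
  have nth: "P ! (i + t) = (replicate h Up @ replicate h Down) ! t" if "t < 2 * h" for t
    using that len eq by (metis le_add1 le_trans nth_drop nth_take)
  show "h \<ge> 1 \<and> i + 2 * h \<le> length P \<and>
     (\<forall>t<h. P ! (i + t) = Up \<and> P ! (i + h + t) = Down)"
  proof (intro conjI allI impI)
    fix t assume "t < h"
    then show "P ! (i + t) = Up" "P ! (i + h + t) = Down"
      using nth[of t] nth[of "h + t"] by (simp_all add: nth_append add.assoc)
  qed fact+
next
  assume r: "h \<ge> 1 \<and> i + 2 * h \<le> length P \<and>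
     (\<forall>t<h. P ! (i + t) = Up \<and> P ! (i + h + t) = Down)"
  have "take (2 * h) (drop i P) = replicate h Up @ replicate h Down"
  proof (rule nth_equalityI)
    fix t assume "t < length (take (2 * h) (drop i P))"
    then have "t < 2 * h" by simp
    have "take (2 * h) (drop i P) ! t = P ! (i + t)"
      using r \<open>t < 2 * h\<close> by simp
    also have "\<dots> = (replicate h Up @ replicate h Down) ! t"
    proof (cases "t < h")
      case False
      then have "t - h < h" "i + t = i + h + (t - h)" using \<open>t < 2 * h\<close> by auto
      then show ?thesis using r False by (simp only: nth_append) simp
    qed (use r in \<open>simp add: nth_append\<close>)
    finally show "take (2 * h) (drop i P) ! t = (replicate h Up @ replicate h Down) ! t" .
  qed (use r in auto)
  then show "pyramid P i h" using r by (simp add: pyramid_def)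
qed

text \<open>Two pyramids with the same peak are nested, so only one of them is maximal.\<close>

lemma maximal_pyramid_unique:
  assumes "maximal_pyramid P i h" "maximal_pyramid P i' h'" "i + h = i' + h'"
  shows "i = i' \<and> h = h'"
proof -
  have False
    if m: "maximal_pyramid P i h" "maximal_pyramid P i' h'" "i + h = i' + h'" "h < h'" for i h i' h'
  proof -
    have p: "pyramid P i' h'" using m by (simp add: maximal_pyramid_def)
    \<comment> \<open>With a common peak, the extension of the smaller pyramid starts at offset
      \<open>h' - Suc h\<close> inside the larger one and is contained in it.\<close>
    have i: "i \<ge> 1" "i - 1 = i' + (h' - Suc h)" using m by auto
    have "P ! (i - 1 + t) = Up" "P ! (i - 1 + Suc h + t) = Down" if "t < Suc h" for t
    proof -
      have "h' - Suc h + t < h'" using that m by auto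
      then have "P ! (i' + (h' - Suc h + t)) = Up" using p by (simp add: pyramid_iff_nth)
      then show "P ! (i - 1 + t) = Up" using i(2) by (simp add: add.assoc)
      have "P ! (i' + h' + t) = Down" using that m p by (simp add: pyramid_iff_nth)
      then show "P ! (i - 1 + Suc h + t) = Down" using m i(1) by simp
    qed
    moreover have "i - 1 + 2 * Suc h \<le> length P"
      using m i p by (simp add: pyramid_iff_nth)
    ultimately have "pyramid P (i - 1) (h + 1)" by (simp add: pyramid_iff_nth)
    then show False using m i by (simp add: maximal_pyramid_def)
  qed
  then show ?thesis using assms by (metis add_right_cancel linorder_neqE_nat)
qed

lemma nth_pyr_append:
  "p < 2 * i \<Longrightarrow> (pyr i @ X) ! p = (if p < i then Up else Down)"
  by (auto simp: pyr_def nth_append)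

text \<open>\<open>Suc p\<close> is the abscissa of a peak, the vertex between the steps
  \<open>p\<close> and \<open>Suc p\<close>. Within the first pyramid only the middle is a peak;
  later positions are handled by induction, and the trailing down steps contain none.\<close>

lemma peak_concat_pyr:
  assumes "(concat (map pyr is) @ replicate k Down) ! p = Up"
    "(concat (map pyr is) @ replicate k Down) ! Suc p = Down"
    "Suc p < 2 * sum_list is + k"
  shows "\<exists>j<length is. Suc p = 2 * sum_list (take j is) + is ! j"
  using assms
proof (induction "is" arbitrary: p)
  case (Cons i "is")
  let ?W = "concat (map pyr is) @ replicate k Down"
  have W: "concat (map pyr (i # is)) @ replicate k Down = pyr i @ ?W" by simp
  show ?case
  proof (cases "p < 2 * i")
    case True
    then have "p < i" using Cons.prems(1) nth_pyr_append[OF True, of ?W] by (auto split: if_splits)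
    moreover have "\<not> Suc p < i"
      using Cons.prems(2) nth_pyr_append[of "Suc p" i ?W] by auto
    ultimately show ?thesis by (intro exI[of _ 0]) auto
  next
    case False
    then obtain q where q: "p = 2 * i + q" by (metis le_add_diff_inverse not_less)
    have "?W ! q = Up" "?W ! Suc q = Down" "Suc q < 2 * sum_list is + k"
      using Cons.prems unfolding W q by (simp_all add: nth_append)
    from Cons.IH[OF this] obtain j where
      "j < length is" "Suc q = 2 * sum_list (take j is) + is ! j" by auto
    then show ?thesis using q by (intro exI[of _ "Suc j"]) auto
  qed
qed simp

text \<open>Extending a listed pyramid needs \<open>Up\<close> before it and \<open>Down\<close>
  after it. The first one is followed by the \<open>Up\<close> of the second, and every other one is
  preceded by a \<open>Down\<close>. Conversely, the peak of any maximal pyramid is the peak of a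
  listed one, so \<open>maximal_pyramid_unique\<close> identifies them.\<close>

lemma maximal_pyramids_pyramid_row:
  assumes "\<forall>i\<in>set is. i \<ge> 1" "length is \<ge> 2"
  shows "{(i, h). maximal_pyramid (pyramid_row k is) i h}
    = (\<lambda>j. (k + 2 * sum_list (take j is), is ! j)) ` {..<length is}" (is "?M = ?f ` _")
    and "j < length is \<Longrightarrow>
      altitude (pyramid_row k is) (k + 2 * sum_list (take j is)) (is ! j) = int k"
proof -
  let ?P = "pyramid_row k is"
  \<comment> \<open>\<open>A j\<close> and \<open>B j\<close> are the parts before and after pyramid
    \<open>j\<close>, which therefore starts at abscissa \<open>length (A j)\<close>.\<close>
  define A where "A j = replicate k Up @ concat (map pyr (take j is))" for j
  define B where "B j = concat (map pyr (drop (Suc j) is)) @ replicate k Down" for j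
  have lenA: "length (A j) = k + 2 * sum_list (take j is)" for j by (simp add: A_def)
  have P: "?P = A j @ pyr (is ! j) @ B j" if "j < length is" for j
  proof -
    have "concat (map pyr is) = concat (map pyr (take j is @ is ! j # drop (Suc j) is))"
      using that by (simp add: id_take_nth_drop[symmetric])
    then show ?thesis by (simp add: pyramid_row_def A_def B_def)
  qed
  show "altitude ?P (k + 2 * sum_list (take j is)) (is ! j) = int k" if "j < length is" for j
    unfolding altitude_def P[OF that] lenA[symmetric]
    by (simp add: ordinate_append ordinate_length_le) (simp add: A_def)
  have maximal: "maximal_pyramid ?P (length (A j)) (is ! j)" if j: "j < length is" for j
  proof -
    let ?h = "is ! j" and ?i = "length (A j)"
    have h: "?h \<ge> 1" using assms(1) j by simp
    have "pyramid ?P ?i ?h"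
      using h by (simp add: pyramid_def P[OF j] pyr_def)
    moreover have False if "?i \<ge> 1" "pyramid ?P (?i - 1) (?h + 1)"
    proof -
      have U: "?P ! (?i - 1) = Up" and D': "?P ! (?i - 1 + (?h + 1) + ?h) = Down"
        using that(2) unfolding pyramid_iff_nth by auto
      have "?i - 1 + (?h + 1) + ?h = ?i + 2 * ?h" using that(1) by linarith
      with D' have D: "?P ! (?i + 2 * ?h) = Down" by (simp only:)
      show False
      proof (cases "j = 0")
        case True
        let ?is = "drop 1 is"
        have "?is \<noteq> []" "\<forall>i\<in>set ?is. i \<ge> 1"
          using assms by (auto dest: in_set_dropD)
        then have "hd (B 0) = Up" "B 0 \<noteq> []"
          using hd_concat_pyr[of ?is] by (cases ?is; auto simp: B_def hd_append)+
        moreover have "?P ! (?i + 2 * ?h) = B j ! 0"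
          by (simp add: P[OF j] nth_append)
        ultimately show False using D True by (simp add: hd_conv_nth)
      next
        case False
        have ne: "take j is \<noteq> []" "\<forall>i\<in>set (take j is). i \<ge> 1"
          using False j assms by (auto dest: in_set_takeD)
        then have "concat (map pyr (take j is)) \<noteq> []" by (cases "take j is") auto
        then have "last (A j) = Down" "A j \<noteq> []"
          using last_concat_pyr[OF ne] by (auto simp: A_def last_append)
        moreover have "?P ! (?i - 1) = last (A j)"
          using \<open>A j \<noteq> []\<close> by (simp add: P[OF j] nth_append last_conv_nth)
        ultimately show False using U by simp
      qed
    qed
    ultimately show ?thesis by (auto simp: maximal_pyramid_def)
  qed
  show "?M = ?f ` {..<length is}"
  proof (intro subset_antisym subsetI)
    fix p assume "p \<in> ?M"
    then obtain i h where p: "p = (i, h)" and m: "maximal_pyramid ?P i h" by auto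
    have pyr: "pyramid ?P i h" using m by (simp add: maximal_pyramid_def)
    \<comment> \<open>The position of the last up step of the pyramid; the instances
      \<open>h - 1\<close> and \<open>0\<close> below yield its last \<open>Up\<close> and its first
      \<open>Down\<close>.\<close>
    define q where "q = i + h - 1"
    have h: "h \<ge> 1" and len: "Suc q < length ?P" and U: "?P ! q = Up" and D: "?P ! Suc q = Down"
      using pyr[unfolded pyramid_iff_nth, THEN conjunct2, THEN conjunct2, rule_format, of "h - 1"]
        pyr[unfolded pyramid_iff_nth, THEN conjunct2, THEN conjunct2, rule_format, of 0]
        pyr[unfolded pyramid_iff_nth] by (auto simp: q_def)
    let ?W = "concat (map pyr is) @ replicate k Down"
    have "is \<noteq> []" using assms(2) by auto
    have hdW: "?W ! 0 = Up" "?W \<noteq> []"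
      using hd_concat_pyr[OF \<open>is \<noteq> []\<close> assms(1)] assms \<open>is \<noteq> []\<close>
      by (cases "is"; auto simp: hd_conv_nth[symmetric] hd_append)+
    \<comment> \<open>A step of the initial run is followed by another one or by the first step of
      the first pyramid, in both cases \<open>Up\<close>.\<close>
    have "q \<ge> k"
    proof (rule ccontr)
      assume "\<not> q \<ge> k"
      then consider "Suc q < k" | "Suc q = k" by linarith
      then show False
        using D hdW by cases (auto simp: pyramid_row_def nth_append)
    qed
    then obtain r where r: "q = k + r" by (metis le_iff_add)
    have "?W ! r = Up" "?W ! Suc r = Down" "Suc r < 2 * sum_list is + k"
      using U D len by (simp_all add: r pyramid_row_def nth_append)
    then obtain j where j: "j < length is" "Suc r = 2 * sum_list (take j is) + is ! j"
      using peak_concat_pyr by blast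
    then have "i + h = length (A j) + is ! j"
      using h r by (simp add: lenA q_def)
    then have "i = length (A j) \<and> h = is ! j"
      using maximal_pyramid_unique[OF m maximal[OF j(1)]] by blast
    then show "p \<in> ?f ` {..<length is}" using p j(1) by (auto simp: lenA)
  next
    fix p assume "p \<in> ?f ` {..<length is}"
    then show "p \<in> ?M" using maximal by (auto simp: lenA)
  qed
qed

section \<open>Weights of pyramids and rows\<close>

lemma primitive_weight_pyr: "primitive_weight \<alpha> \<beta> \<gamma> (pyr n) = \<gamma> n"
  by (simp add: primitive_weight_def)

text \<open>All maximal pyramids have altitude \<open>k \<ge> 1\<close>, so the altitude condition
  in the weight excludes none of them.\<close>

lemma primitive_weight_pyramid_row:
  assumes "\<forall>i\<in>set is. i \<ge> 1" "length is \<ge> 2" "k \<ge> 1"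
  shows "primitive_weight \<alpha> \<beta> \<gamma> (pyramid_row k is) = \<beta> k * (\<Prod>i\<leftarrow>is. \<alpha> i)"
proof -
  let ?P = "pyramid_row k is" and ?f = "\<lambda>j. (k + 2 * sum_list (take j is), is ! j)"
  note max = maximal_pyramids_pyramid_row[OF assms(1,2), where k = k]
  have "{(i, h). maximal_pyramid ?P i h \<and> altitude ?P i h \<ge> 1}
      = {(i, h). maximal_pyramid ?P i h} \<inter> {(i, h). altitude ?P i h \<ge> 1}" by auto
  also have "\<dots> = ?f ` {..<length is}"
    unfolding max(1) using max(2) assms(3) by auto
  finally have set: "{(i, h). maximal_pyramid ?P i h \<and> altitude ?P i h \<ge> 1} = ?f ` {..<length is}" .
  \<comment> \<open>Heights may repeat; distinct starting points are what turns the product over a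
    set of pairs into a product over the list.\<close>
  have mono: "sum_list (take j is) < sum_list (take l is)" if "j < l" "l \<le> length is" for j l
    using that
  proof (induction l)
    case (Suc l)
    have "is ! l \<ge> 1" using Suc.prems assms(1) by simp
    then show ?case using Suc by (cases "j = l") (auto simp: take_Suc_conv_app_nth)
  qed simp
  have "inj_on ?f {..<length is}"
    by (rule linorder_inj_onI) (auto dest: mono)
  then have "(\<Prod>(i, h)\<in>?f ` {..<length is}. \<alpha> h) = (\<Prod>j<length is. \<alpha> (is ! j))"
    by (simp add: prod.reindex)
  also have "\<dots> = (\<Prod>i\<leftarrow>is. \<alpha> i)"
    by (simp add: prod.list_conv_set_nth atLeast0LessThan)
  finally show ?thesis
    by (simp add: primitive_weight_def valley_levels_pyramid_row[OF assms(1,2)] set)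
qed

section \<open>Primitive paths with valleys on one level\<close>

text \<open>The union of the sets \<open>\<A>\<close> before paths of weight zero are
  discarded.\<close>

definition one_level_paths :: "step list set" where
  "one_level_paths = {P. (\<exists>n. primitive_path n P) \<and> (\<exists>k. valley_levels P \<subseteq> {k})}"

text \<open>Splitting off two heights makes the parameters range over a product set, as
  \<open>gf_Times\<close> requires.\<close>

definition row_of :: "nat \<times> nat \<times> nat \<times> nat list \<Rightarrow> step list" where
  "row_of = (\<lambda>(k, i, j, is). pyramid_row k (i # j # is))"

abbreviation row_params :: "(nat \<times> nat \<times> nat \<times> nat list) set" where
  "row_params \<equiv> {1..} \<times> {1..} \<times> {1..} \<times> lists {1..}"

lemma one_level_paths_eq: "one_level_paths = pyr ` {1..} \<union> row_of ` row_params"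
proof (intro subset_antisym subsetI)
  fix P assume "P \<in> one_level_paths"
  then obtain n k where prim: "primitive_path n P" and lev: "valley_levels P \<subseteq> {k}"
    by (auto simp: one_level_paths_def)
  have h: "height P = 0" "length P = 2 * n" and ne: "P \<noteq> []"
    using prim by (auto simp: primitive_path_def dyck_path_iff)
  show "P \<in> pyr ` {1..} \<union> row_of ` row_params"
  proof (cases "valley_levels P = {}")
    case True
    then obtain i where "P = pyr i" using valley_levels_empty_decomp h by blast
    then show ?thesis using ne by auto
  next
    case False
    then have lev: "valley_levels P = {k}" using lev by blast
    then have "k \<in> valley_levels P" by simp
    then obtain i where i: "valley P i" "ordinate P i = k" by (auto simp: valley_levels_def)
    then have "0 < i" "i < 2 * n" using h(2) by (auto simp: valley_def)
    \<comment> \<open>A valley at level 0 would be a return to the axis between the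
      endpoints.\<close>
    then have "k \<noteq> 0"
      using prim i(2) unfolding primitive_path_def by (metis less_imp_le less_not_refl)
    moreover have "k \<ge> 0"
      using prim i(2) by (auto simp: primitive_path_def dyck_path_iff)
    ultimately obtain m where m: "k = int m" "m \<ge> 1"
      by (metis One_nat_def Suc_leI of_nat_0 neq0_conv nonneg_int_cases)
    then obtain "is" where "is": "\<forall>i\<in>set is. i \<ge> 1" "length is \<ge> 2" "P = pyramid_row m is"
      using valley_levels_singleton_decomp[of P m] lev h by auto
    \<comment> \<open>The case rule of \<open>remdups_adj\<close> distinguishes lists with no, one
      and at least two entries.\<close>
    then obtain a b js where "is = a # b # js"
      by (cases "is" rule: remdups_adj.cases) auto
    then have "P = row_of (m, a, b, js)" "(m, a, b, js) \<in> row_params"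
      using "is" m by (auto simp: row_of_def)
    then show ?thesis by blast
  qed
next
  fix P assume "P \<in> pyr ` {1..} \<union> row_of ` row_params"
  then consider i where "i \<ge> 1" "P = pyr i"
    | k a b js where "k \<ge> 1" "\<forall>i\<in>set (a # b # js). i \<ge> 1" "P = pyramid_row k (a # b # js)"
    by (auto simp: row_of_def)
  then show "P \<in> one_level_paths"
  proof cases
    case 1
    then show ?thesis using primitive_path_pyr by (auto simp: one_level_paths_def)
  next
    case 2
    then show ?thesis
      using primitive_path_pyramid_row[OF 2(1)] valley_levels_pyramid_row[OF 2(2)]
      by (auto simp: one_level_paths_def)
  qed
qed

lemma finite_levels_half_length: "finite_levels (S :: step list set) (\<lambda>P. length P div 2)"
  unfolding finite_levels_def
proof
  fix n
  have "UNIV = {Up, Down}" by (auto intro: step.exhaust)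
  then have "finite (UNIV :: step set)" by (metis finite.emptyI finite.insertI)
  \<comment> \<open>Halving rounds down, so half-length \<open>n\<close> admits the lengths
    \<open>2 * n\<close> and \<open>2 * n + 1\<close>.\<close>
  then have "finite {P :: step list. set P \<subseteq> UNIV \<and> length P \<le> 2 * n + 1}"
    by (rule finite_lists_length_le)
  then show "finite {P\<in>S. length P div 2 = n}"
    by (rule rev_finite_subset) auto
qed

text \<open>Pyramids and rows are told apart by having a valley. A row determines \<open>k\<close>
  by its valley level and its heights by \<open>concat_pyr_inject\<close>, so both kinds are counted
  by their parameters.\<close>

lemma gf_one_level_paths:
  fixes \<alpha> \<beta> \<gamma> :: "nat \<Rightarrow> 'a::field"
  shows "gf one_level_paths (\<lambda>P. length P div 2) (primitive_weight \<alpha> \<beta> \<gamma>)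
    = weight_fps \<gamma> + (weight_fps \<alpha>)\<^sup>2 * weight_fps \<beta> / (1 - weight_fps \<alpha>)"
proof -
  let ?sz = "\<lambda>P :: step list. length P div 2" and ?w = "primitive_weight \<alpha> \<beta> \<gamma>"
  let ?L = "lists {1..} :: nat list set" and ?p = "\<lambda>is. \<Prod>i\<leftarrow>is. \<alpha> i"
  have lev: "valley_levels (row_of x) = {int (fst x)}" if "x \<in> row_params" for x
    using that valley_levels_pyramid_row by (auto simp: row_of_def)
  have disj: "pyr ` {1..} \<inter> row_of ` row_params = {}"
  proof (rule ccontr)
    assume "pyr ` {1..} \<inter> row_of ` row_params \<noteq> {}"
    then obtain i x where "x \<in> row_params" "pyr i = row_of x" by blast
    then show False using lev[of x] valley_levels_pyr[of i] by simp
  qed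
  have inj: "inj_on row_of row_params"
  proof (rule inj_onI)
    fix x y assume xy: "x \<in> row_params" "y \<in> row_params" "row_of x = row_of y"
    obtain k a b l where x: "x = (k, a, b, l)" by (metis surj_pair)
    obtain k' a' b' l' where y: "y = (k', a', b', l')" by (metis surj_pair)
    have "k = k'" using lev[OF xy(1)] lev[OF xy(2)] xy(3) by (simp add: x y)
    moreover have "a # b # l = a' # b' # l'"
    proof (rule concat_pyr_inject)
      show "concat (map pyr (a # b # l)) = concat (map pyr (a' # b' # l'))"
        using xy(3) \<open>k = k'\<close> by (simp add: x y row_of_def pyramid_row_def)
    qed (use xy in \<open>auto simp: x y\<close>)
    ultimately show "x = y" by (simp add: x y)
  qed
  have injp: "inj_on pyr {1..}"
    by (rule inj_onI) (metis length_pyr mult_left_cancel zero_neq_numeral)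
  have g: "gf (pyr ` {1..}) ?sz ?w = weight_fps \<gamma>"
    unfolding gf_weight_fps[symmetric]
    by (rule gf_bij[where f = pyr]) (use injp in \<open>auto simp: bij_betw_def primitive_weight_pyr\<close>)
  have finL: "finite_levels ?L (\<lambda>is. \<Sum>i\<leftarrow>is. i)"
    by (rule finite_levels_lists) (auto simp: finite_levels_nat)
  \<comment> \<open>The nested \<open>case\<close> form matches three successive uses of
    \<open>gf_Times\<close>.\<close>
  have "gf (row_of ` row_params) ?sz ?w
      = gf row_params (\<lambda>(k, y). k + (case y of (i, z) \<Rightarrow> i + (case z of (j, is) \<Rightarrow> j + (\<Sum>i\<leftarrow>is. i))))
          (\<lambda>(k, y). \<beta> k * (case y of (i, z) \<Rightarrow> \<alpha> i * (case z of (j, is) \<Rightarrow> \<alpha> j * ?p is)))"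
    by (rule gf_bij[where f = row_of])
      (use inj in \<open>auto simp: bij_betw_def row_of_def primitive_weight_pyramid_row\<close>)
  also have "\<dots> = weight_fps \<beta> * (weight_fps \<alpha> * (weight_fps \<alpha> * gf ?L (\<lambda>is. \<Sum>i\<leftarrow>is. i) ?p))"
    by (simp only: gf_Times gf_weight_fps finite_levels_nat finL finite_levels_Times)
  also have "gf ?L (\<lambda>is. \<Sum>i\<leftarrow>is. i) ?p = 1 / (1 - weight_fps \<alpha>)"
    unfolding gf_weight_fps[symmetric] by (rule gf_lists) (auto simp: finite_levels_nat)
  also have "weight_fps \<beta> * (weight_fps \<alpha> * (weight_fps \<alpha> * (1 / (1 - weight_fps \<alpha>))))
      = (weight_fps \<alpha>)\<^sup>2 * weight_fps \<beta> / (1 - weight_fps \<alpha>)"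
    by (simp add: fps_divide_unit weight_fps_def power2_eq_square mult_ac)
  finally show ?thesis
    unfolding one_level_paths_eq
    by (simp only: gf_Un[OF finite_levels_half_length finite_levels_half_length disj] g)
qed

section \<open>Factorization into primitive paths\<close>

text \<open>One of the two paths is a prefix of the other. The end of the shorter is a return to the
  axis of the longer, hence also its end.\<close>

lemma primitive_path_prefix_eq:
  assumes "primitive_path m P" "primitive_path n Q" "P @ X = Q @ Y"
  shows "P = Q"
proof -
  have no_prefix: "Z = []" if "primitive_path m P" "primitive_path n (P @ Z)" for m n P Z
  proof -
    have P: "length P = 2 * m" "height P = 0" "P \<noteq> []" and len: "length (P @ Z) = 2 * n"
      using that by (auto simp: primitive_path_def dyck_path_iff)
    have "ordinate (P @ Z) (2 * m) = 0"
      using P by (simp add: ordinate_append ordinate_length_le)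
    moreover have "2 * m \<le> 2 * n" "2 * m \<noteq> 0"
      using P len primitive_path_pos[OF that(1)] by auto
    ultimately have "2 * m = 2 * n" using that(2) by (metis primitive_path_def)
    then show ?thesis using P len by simp
  qed
  obtain Z where "P = Q @ Z \<or> Q = P @ Z"
    using assms(3) by (metis append_eq_append_conv2)
  then show ?thesis using no_prefix assms(1,2) by auto
qed

text \<open>The first factors agree by \<open>primitive_path_prefix_eq\<close>; cancel them and
  induct.\<close>

lemma primitive_factorization_unique:
  assumes "\<forall>P\<in>set Ps. \<exists>n. primitive_path n P" "\<forall>Q\<in>set Qs. \<exists>n. primitive_path n Q"
    "concat Ps = concat Qs"
  shows "Ps = Qs"
  using assms
proof (induction Ps arbitrary: Qs)
  case Nil
  then show ?case by (cases Qs) (auto simp: primitive_path_def)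
next
  case (Cons P Ps)
  have "P \<noteq> []" using Cons.prems(1) by (auto simp: primitive_path_def)
  then obtain Q Qs' where Qs: "Qs = Q # Qs'" using Cons.prems(3) by (cases Qs) auto
  then have "P = Q"
    using Cons.prems by (auto intro: primitive_path_prefix_eq)
  then show ?case using Cons.IH[of Qs'] Cons.prems Qs by simp
qed

lemma dyck_path_concat:
  assumes "\<forall>P\<in>set Ps. \<exists>n. primitive_path n P"
  shows "dyck_path (\<Sum>P\<leftarrow>Ps. length P div 2) (concat Ps)"
  using assms
proof (induction Ps)
  case (Cons P Ps)
  then obtain n where "primitive_path n P" by auto
  then have "dyck_path (length P div 2) P" by (simp add: primitive_path_def dyck_path_iff)
  then show ?case using Cons by (simp add: dyck_path_append)
qed (simp add: dyck_path_Nil)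

theorem theorem2p1:
  fixes \<alpha> \<beta> \<gamma> :: "nat \<Rightarrow> 'a::field"
  shows "Abs_fps (total_weight \<alpha> \<beta> \<gamma>) =
    1 / (1 - weight_fps \<gamma> - (weight_fps \<alpha>)\<^sup>2 * weight_fps \<beta> / (1 - weight_fps \<alpha>))"
proof -
  let ?sz = "\<lambda>P :: step list. length P div 2" and ?w = "primitive_weight \<alpha> \<beta> \<gamma>"
  define S where "S = (\<Union>s\<in>{1..}. \<A> \<alpha> \<beta> \<gamma> s)"
  have S_eq: "S = {P\<in>one_level_paths. ?w P \<noteq> 0}"
  proof -
    have "P \<in> S \<longleftrightarrow> P \<in> one_level_paths \<and> ?w P \<noteq> 0" for P
      unfolding S_def \<A>_def one_level_paths_def UN_iff mem_Collect_eq atLeast_iff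
      using primitive_path_pos by blast
    then show ?thesis by blast
  qed
  have prim: "\<exists>n. primitive_path n P" if "P \<in> S" for P
    using that by (auto simp: S_eq one_level_paths_def)
  have pos: "?sz P \<ge> 1" if "P \<in> S" for P
  proof -
    obtain n where n: "primitive_path n P" using prim \<open>P \<in> S\<close> by blast
    then have "length P = 2 * n" by (simp add: primitive_path_def dyck_path_iff)
    then show ?thesis using primitive_path_pos[OF n] by simp
  qed
  have inj: "inj_on concat (lists S)"
    by (rule inj_onI) (use primitive_factorization_unique prim in blast)
  \<comment> \<open>Concatenations of primitive paths are Dyck paths, so the Dyck condition only
    fixes the half-length.\<close>
  have V: "\<V> \<alpha> \<beta> \<gamma> n = {P\<in>concat ` lists S. ?sz P = n}" for n
  proof -
    have dyck: "dyck_path n (concat Ps) \<longleftrightarrow> ?sz (concat Ps) = n" if "Ps \<in> lists S" for Ps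
      using dyck_path_concat[of Ps] prim that by (auto simp: dyck_path_iff)
    have "\<V> \<alpha> \<beta> \<gamma> n = {P. dyck_path n P \<and> (\<exists>Ps\<in>lists S. P = concat Ps)}"
      unfolding \<V>_def S_def[symmetric] lists_eq_set by blast
    also have "\<dots> = {P. (\<exists>Ps\<in>lists S. P = concat Ps) \<and> ?sz P = n}"
      by (intro Collect_cong) (metis dyck)
    finally show ?thesis by (simp only: image_iff)
  qed
  have pw: "path_weight \<alpha> \<beta> \<gamma> (concat Ps) = (\<Prod>P\<leftarrow>Ps. ?w P)" if "Ps \<in> lists S" for Ps
  proof -
    \<comment> \<open>Unique factorization makes the definite description in
      \<open>path_weight\<close> denote the given list.\<close>
    have "(THE Qs. set Qs \<subseteq> S \<and> concat Ps = concat Qs) = Ps"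
      using that inj_onD[OF inj] by (intro the_equality) (simp_all only: lists_eq_set mem_Collect_eq)
    then show ?thesis unfolding path_weight_def S_def[symmetric] by (simp only: Let_def)
  qed
  have sz: "?sz (concat Ps) = (\<Sum>P\<leftarrow>Ps. ?sz P)" if "Ps \<in> lists S" for Ps
    using dyck_path_concat[of Ps] prim that by (auto simp: dyck_path_iff)
  have "Abs_fps (total_weight \<alpha> \<beta> \<gamma>) = gf (concat ` lists S) ?sz (path_weight \<alpha> \<beta> \<gamma>)"
    by (simp add: gf_def total_weight_def[abs_def] V)
  also have "\<dots> = gf (lists S) (\<lambda>Ps. \<Sum>P\<leftarrow>Ps. ?sz P) (\<lambda>Ps. \<Prod>P\<leftarrow>Ps. ?w P)"
    by (rule gf_bij[where f = concat]) (use inj sz pw in \<open>auto simp: bij_betw_def\<close>)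
  also have "\<dots> = 1 / (1 - gf S ?sz ?w)"
    by (rule gf_lists) (use finite_levels_half_length pos in auto)
  also have "gf S ?sz ?w = gf one_level_paths ?sz ?w"
    unfolding S_eq by (rule gf_nonzero[OF finite_levels_half_length])
  finally show ?thesis
    by (simp add: gf_one_level_paths algebra_simps)
qed

end
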